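(* Let $\mathfrak a_{n,m,d}$ be the number of $\sigma\in\mathcal{I}_n(000,010)$ with $\max(\sigma)=m$ and exactly $d$ distinct values. Let $\mathfrak b_{n,k}$ be the number of words $\omega$ of length $n$ over $\{0,\dots,k-1\}$ avoiding both $000$ and $010$, in which every letter of $\{0,\dots,k-1\}$ appears at least once, and with $\omega_1=k-1$. Then for all integers $2\leqslant d\leqslant m+1\leqslant n$, $$\mathfrak a_{n,m,d}=\sum_{i=0}^{d-1}\binom{m-i}{d-i-1}\sum_{p=m+1}^{n}\mathfrak b_{n-p+1,d-i}\sum_{j=0}^{m-1}\mathfrak a_{p-1,j,i}.$$
   Context: For $n\in\mathbb N$, an inversion sequence of size $n$ is a sequence $\sigma=(\sigma_1,\dots,\sigma_n)\in\mathbb N^n$ with $\sigma_i<i$ for all $i$. An integer sequence contains a pattern $\rho$ (a finite integer sequence such as $000$ or $010$) if it has a subsequence order-isomorphic to $\rho$, and avoids $\rho$ otherwise. $\mathcal{I}_n(P)$ denotes the set of inversion sequences of size $n$ avoiding every pattern in $P$. $\max(\sigma)$ is the largest entry of $\sigma$; for the empty sequence, $\max=-1$ and the number of distinct values is $0$. *)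

theory Defs
  imports Main "HOL-Library.Sublist"
begin

definition order_isomorphic :: "'a::linorder list \<Rightarrow> 'b::linorder list \<Rightarrow> bool" where
  "order_isomorphic xs ys \<longleftrightarrow>
     length xs = length ys \<and>
     (\<forall>i<length xs. \<forall>j<length xs. xs ! i < xs ! j \<longleftrightarrow> ys ! i < ys ! j)"

definition contains_pattern :: "'a::linorder list \<Rightarrow> 'b::linorder list \<Rightarrow> bool" where
  "contains_pattern \<sigma> \<rho> \<longleftrightarrow> (\<exists>\<tau>. subseq \<tau> \<sigma> \<and> order_isomorphic \<tau> \<rho>)"

definition avoids :: "'a::linorder list \<Rightarrow> 'b::linorder list \<Rightarrow> bool" where
  "avoids \<sigma> \<rho> \<longleftrightarrow> \<not> contains_pattern \<sigma> \<rho>"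

text \<open>The usual condition \<open>\<sigma>\<^sub>i < i\<close> is for positions counted from 1; list positions
  are counted from 0.\<close>

definition inversion_sequence :: "nat list \<Rightarrow> bool" where
  "inversion_sequence \<sigma> \<longleftrightarrow> (\<forall>i<length \<sigma>. \<sigma> ! i < i + 1)"

definition avoiding_inversion_sequences :: "nat \<Rightarrow> nat list set \<Rightarrow> nat list set" where
  "avoiding_inversion_sequences n P =
     {\<sigma>. length \<sigma> = n \<and> inversion_sequence \<sigma> \<and> (\<forall>\<rho>\<in>P. avoids \<sigma> \<rho>)}"

definition max_entry :: "nat list \<Rightarrow> int" where
  "max_entry \<sigma> = (if \<sigma> = [] then -1 else int (Max (set \<sigma>)))"

definition a_count :: "nat \<Rightarrow> int \<Rightarrow> nat \<Rightarrow> nat" where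
  "a_count n m d =
     card {\<sigma> \<in> avoiding_inversion_sequences n {[0,0,0], [0,1,0]}.
             max_entry \<sigma> = m \<and> card (set \<sigma>) = d}"

text \<open>The condition \<open>\<omega>\<^sub>1 = k - 1\<close> is written without subtraction, which would truncate
  at \<open>k = 0\<close>; no word of length 0 satisfies it.\<close>

definition b_count :: "nat \<Rightarrow> nat \<Rightarrow> nat" where
  "b_count n k =
     card {\<omega> :: nat list. length \<omega> = n \<and> set \<omega> \<subseteq> {..<k} \<and>
             (\<forall>\<rho>\<in>{[0,0,0], [0,1,0::nat]}. avoids \<omega> \<rho>) \<and>
             (\<forall>c<k. c \<in> set \<omega>) \<and> \<omega> \<noteq> [] \<and> hd \<omega> + 1 = k}"

end

(* Cut a sequence in front of the first occurrence of its maximum m. A value on both sides of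
   the cut would form a 010 with that m, so the two sides use disjoint sets of values; conversely,
   any two pattern-avoiding words with disjoint value sets concatenate to a pattern-avoiding word.
   If the cut is at position p and i values occur before it, the values after it are m and d-i-1 of
   the m-i unused values below m, and relabelling them in increasing order gives a word counted by
   b. Since p > m, the right-hand side satisfies the inversion-sequence bound automatically. *)
theory Submission
  imports Defs "HOL-Library.Infinite_Set"
begin

section \<open>Both patterns as one condition on repeated values\<close>

definition repeats_dominate :: "'a::linorder list \<Rightarrow> bool" where
  "repeats_dominate \<sigma> \<longleftrightarrow> (\<forall>x y. subseq [x, y, x] \<sigma> \<longrightarrow> y < x)"

lemma length_3_conv: "length xs = 3 \<longleftrightarrow> (\<exists>x y z. xs = [x, y, z])"
  by (auto simp: length_Suc_conv numeral_3_eq_3)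

lemma order_isomorphic_000:
  "order_isomorphic xs [0, 0, 0::nat] \<longleftrightarrow> (\<exists>x. xs = [x, x, x])"
proof
  assume "order_isomorphic xs [0, 0, 0::nat]"
  then have len: "length xs = 3"
    and ord: "\<And>i j. i < 3 \<Longrightarrow> j < 3 \<Longrightarrow> \<not> xs ! i < xs ! j"
    by (auto simp: order_isomorphic_def numeral_3_eq_3 less_Suc_eq nth_Cons')
  from len obtain x y z where xs: "xs = [x, y, z]"
    by (auto simp: length_3_conv)
  have "\<not> x < y" "\<not> y < x" "\<not> y < z" "\<not> z < y"
    using ord[of 0 1] ord[of 1 0] ord[of 1 2] ord[of 2 1] by (auto simp: xs)
  then show "\<exists>x. xs = [x, x, x]"
    using xs by auto
qed (auto simp: order_isomorphic_def less_Suc_eq nth_Cons')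

lemma order_isomorphic_010:
  "order_isomorphic xs [0, 1, 0::nat] \<longleftrightarrow> (\<exists>x y. xs = [x, y, x] \<and> x < y)"
proof
  assume iso: "order_isomorphic xs [0, 1, 0::nat]"
  then have len: "length xs = 3"
    and ord: "\<And>i j. i < 3 \<Longrightarrow> j < 3 \<Longrightarrow> xs ! i < xs ! j \<longleftrightarrow> [0, 1, 0::nat] ! i < [0, 1, 0] ! j"
    by (auto simp: order_isomorphic_def)
  from len obtain x y z where xs: "xs = [x, y, z]"
    by (auto simp: length_3_conv)
  have "x < y" "\<not> x < z" "\<not> z < x"
    using ord[of 0 1] ord[of 0 2] ord[of 2 0] by (auto simp: xs)
  then show "\<exists>x y. xs = [x, y, x] \<and> x < y"
    using xs by auto
qed (auto simp: order_isomorphic_def less_Suc_eq nth_Cons')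

text \<open>A subsequence x, y, x is an occurrence of 000 if x = y and of 010 if x < y. Excluding
  both leaves y < x, so one condition stands for the two patterns from here on.\<close>

lemma avoids_000_010_iff:
  "(\<forall>\<rho>\<in>{[0, 0, 0], [0, 1, 0::nat]}. avoids \<sigma> \<rho>) \<longleftrightarrow> repeats_dominate \<sigma>"
proof -
  have "avoids \<sigma> [0, 0, 0::nat] \<longleftrightarrow> (\<forall>x. \<not> subseq [x, x, x] \<sigma>)"
    unfolding avoids_def contains_pattern_def order_isomorphic_000 by auto
  moreover have "avoids \<sigma> [0, 1, 0::nat] \<longleftrightarrow> (\<forall>x y. subseq [x, y, x] \<sigma> \<longrightarrow> \<not> x < y)"
    unfolding avoids_def contains_pattern_def order_isomorphic_010 by auto
  ultimately show ?thesis
    unfolding repeats_dominate_def ball_simps by (metis linorder_cases order_less_irrefl order_less_asym)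
qed

lemma repeats_dominate_subseq:
  "repeats_dominate \<sigma> \<Longrightarrow> subseq \<tau> \<sigma> \<Longrightarrow> repeats_dominate \<tau>"
  unfolding repeats_dominate_def using subseq_order.order_trans by blast

lemma set_mono_subseq: "subseq xs ys \<Longrightarrow> set xs \<subseteq> set ys"
  by (metis notin_set_nthsI subseq_conv_nths subsetI)

text \<open>When x, y, x is divided between \<open>u\<close> and \<open>v\<close>, either one side
  receives all three letters or each side receives a copy of x; disjointness rules out the
  latter.\<close>

lemma repeats_dominate_append:
  assumes disj: "set u \<inter> set v = {}"
  shows "repeats_dominate (u @ v) \<longleftrightarrow> repeats_dominate u \<and> repeats_dominate v"
proof
  assume "repeats_dominate (u @ v)"
  then show "repeats_dominate u \<and> repeats_dominate v"
    by (meson repeats_dominate_subseq prefixI prefix_imp_subseq suffixI suffix_imp_subseq)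
next
  assume uv: "repeats_dominate u \<and> repeats_dominate v"
  have "y < x" if "subseq [x, y, x] (u @ v)" for x y
  proof -
    from that obtain s t where st: "[x, y, x] = s @ t" "subseq s u" "subseq t v"
      by (metis subseq_appendE)
    consider "s = []" | "t = []" | "x \<in> set s" "x \<in> set t"
      using st(1) by (auto simp: Cons_eq_append_conv)
    then show ?thesis
      using st uv disj set_mono_subseq[OF st(2)] set_mono_subseq[OF st(3)]
      by cases (auto simp: repeats_dominate_def)
  qed
  then show "repeats_dominate (u @ v)"
    by (simp add: repeats_dominate_def)
qed

lemma repeats_dominate_map:
  fixes f :: "'a::linorder \<Rightarrow> 'b::linorder"
  assumes f: "strict_mono_on (set w) f"
  shows "repeats_dominate (map f w) \<longleftrightarrow> repeats_dominate w"
proof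
  assume fw: "repeats_dominate (map f w)"
  show "repeats_dominate w"
    unfolding repeats_dominate_def
  proof (intro allI impI)
    fix x y assume xyx: "subseq [x, y, x] w"
    then have "x \<in> set w" "y \<in> set w"
      using set_mono_subseq by fastforce+
    moreover have "f y < f x"
      using subseq_map[OF xyx, of f] fw by (simp add: repeats_dominate_def)
    ultimately show "y < x"
      using strict_mono_on_less[OF f] by blast
  qed
next
  assume w: "repeats_dominate w"
  show "repeats_dominate (map f w)"
    unfolding repeats_dominate_def
  proof (intro allI impI)
    fix x y assume "subseq [x, y, x] (map f w)"
    \<comment> \<open>The occurrence is pulled back along its positions \<open>N\<close>. At first
      the outer letters a and c only have equal images; strict monotonicity then makes them equal,
      so that the hypothesis on \<open>w\<close> applies.\<close>
    then obtain N where "map f (nths w N) = [x, y, x]"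
      by (metis subseq_conv_nths nths_map)
    then obtain a b c where abc: "nths w N = [a, b, c]" "f a = x" "f b = y" "f c = x"
      by (auto simp: map_eq_Cons_conv)
    then have sub: "subseq [a, b, c] w"
      by (metis subseq_conv_nths)
    then have mem: "a \<in> set w" "b \<in> set w" "c \<in> set w"
      using set_mono_subseq by fastforce+
    then have "a = c"
      using abc strict_mono_on_eqD[OF f] by metis
    then have "b < a"
      using sub w by (simp add: repeats_dominate_def)
    then show "y < x"
      using abc mem strict_mono_onD[OF f] by blast
  qed
qed

section \<open>Relabelling words to an initial segment, and counting the possible suffixes\<close>

lemma b_count_eq_words_on:
  fixes V :: "nat set"
  assumes V: "finite V" "m \<in> V" "\<And>x. x \<in> V \<Longrightarrow> x \<le> m"
  shows "card {v. length v = l \<and> v \<noteq> [] \<and> hd v = m \<and> repeats_dominate v \<and> set v = V} =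
    b_count l (card V)"
    (is "card ?W = _")
proof -
  define k where "k = card V"
  have kpos: "0 < k"
    using V card_gt_0_iff k_def by blast
  \<comment> \<open>Relabelling along the increasing enumeration of \<open>V\<close> preserves
    length and pattern avoidance. It sends the top letter \<open>k - 1\<close> to the maximum
    \<open>m\<close>, so the two conditions on the first letter correspond.\<close>
  obtain f where bij: "bij_betw f {..<k} V" and mono: "strict_mono_on {..<k} f"
    unfolding k_def using ex_bij_betw_strict_mono_card[OF V(1)] by metis
  then have inj: "inj_on f {..<k}" and img: "f ` {..<k} = V"
    by (auto simp: bij_betw_def)
  have f_top: "f (k - 1) = m"
  proof -
    \<comment> \<open>The preimage \<open>c\<close> of \<open>m\<close> cannot lie below
      \<open>k - 1\<close>, since otherwise \<open>f (k - 1)\<close> would be an element of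
      \<open>V\<close> above \<open>m\<close>.\<close>
    obtain c where c: "c < k" "f c = m"
      using img V(2) by auto
    have "f (k - 1) \<in> V"
      using kpos img by auto
    then have "\<not> f c < f (k - 1)"
      using V(3) c by fastforce
    then show ?thesis
      using strict_mono_onD[OF mono, of c "k - 1"] c kpos
      by (metis Suc_pred' lessThan_iff less_Suc_eq lessI)
  qed
  \<comment> \<open>The two demands of \<open>b_count\<close>, that all letters lie below
    \<open>k\<close> and that each of them occurs, are merged into
    \<open>set w = {..<k}\<close>.\<close>
  define B where "B = {w. length w = l \<and> set w = {..<k} \<and> repeats_dominate w \<and> w \<noteq> [] \<and> hd w + 1 = k}"
  have "b_count l k = card B"
    unfolding b_count_def B_def avoids_000_010_iff by (rule arg_cong[where f = card]) auto
  moreover have "bij_betw (map f) B ?W"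
  proof (rule bij_betwI')
    fix w w' assume "w \<in> B" "w' \<in> B"
    then have "set w \<union> set w' = {..<k}"
      by (simp add: B_def)
    then show "map f w = map f w' \<longleftrightarrow> w = w'"
      using inj by (simp add: inj_on_map_eq_map)
  next
    fix w assume w: "w \<in> B"
    then have props: "length w = l" "w \<noteq> []" "set w = {..<k}" "repeats_dominate w"
      by (simp_all add: B_def)
    have "hd w = k - 1"
      using w unfolding B_def by (metis (lifting) add_diff_cancel_right' mem_Collect_eq)
    then have "hd (map f w) = m"
      using props f_top by (simp add: hd_map)
    moreover have "repeats_dominate (map f w)"
      using repeats_dominate_map[of w f] mono props by simp
    ultimately show "map f w \<in> ?W"
      using props img by simp
  next
    fix v assume v: "v \<in> ?W"
    let ?g = "inv_into {..<k} f"
    let ?w = "map ?g v"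
    have fg: "f (?g x) = x" if "x \<in> V" for x
      using that img by (metis f_inv_into_f)
    have props: "length v = l" "v \<noteq> []" "hd v = m" "set v = V" "repeats_dominate v"
      using v by simp_all
    have set_w: "set ?w = {..<k}"
      using props(4) bij_betw_imp_surj_on[OF bij_betw_inv_into[OF bij]] by simp
    have fw: "map f ?w = v"
      unfolding map_map using props(4) fg by (intro map_idI) simp
    have "?g m = k - 1"
      using f_top inj kpos by (metis diff_less inv_into_f_f lessThan_iff zero_less_one)
    then have "hd ?w + 1 = k"
      using props(2,3) kpos by (simp add: hd_map)
    moreover have "repeats_dominate ?w"
      using repeats_dominate_map[of ?w f] set_w mono fw props(5) by metis
    ultimately have "?w \<in> B"
      using props(1,2) set_w unfolding B_def by simp
    then show "\<exists>w\<in>B. v = map f w"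
      using fw by metis
  qed
  ultimately show ?thesis
    using bij_betw_same_card[of "map f" B ?W] by (simp only: k_def)
qed

definition suffix_words :: "nat \<Rightarrow> nat \<Rightarrow> nat set \<Rightarrow> nat \<Rightarrow> nat list set" where
  "suffix_words l m U k = {v. length v = l \<and> v \<noteq> [] \<and> hd v = m \<and> repeats_dominate v \<and>
     set v \<subseteq> insert m U \<and> card (set v) = k}"

lemma finite_suffix_words: "finite U \<Longrightarrow> finite (suffix_words l m U k)"
  by (rule finite_subset[OF _ finite_lists_length_eq[of "insert m U" l]])
    (auto simp: suffix_words_def)

text \<open>The words are sorted by their set \<open>T\<close> of values other than
  \<open>m\<close>. As \<open>m\<close> is always present, \<open>T\<close> is a choice of
  \<open>k - 1\<close> elements of \<open>U\<close>, and by relabelling each choice contributes the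
  same number \<open>b_count l k\<close>.\<close>

lemma card_suffix_words:
  assumes U: "U \<subseteq> {..<m}" and k: "0 < k"
  shows "card (suffix_words l m U k) = (card U choose (k - 1)) * b_count l k"
proof -
  define F where "F T = {v. length v = l \<and> v \<noteq> [] \<and> hd v = m \<and> repeats_dominate v \<and>
    set v = insert m T}" for T
  define I where "I = {T. T \<subseteq> U \<and> card T = k - 1}"
  have fin: "finite U"
    using U finite_subset by blast
  have T: "finite T" "m \<notin> T" "T \<subseteq> {..<m}" "card (insert m T) = k" if "T \<in> I" for T
  proof -
    show *: "finite T" "m \<notin> T" "T \<subseteq> {..<m}"
      using that U fin finite_subset by (auto simp: I_def)
    then show "card (insert m T) = k"
      using that k by (auto simp: I_def)
  qed
  have "suffix_words l m U k = (\<Union>T\<in>I. F T)"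
  proof (intro equalityI subsetI)
    fix v assume v: "v \<in> suffix_words l m U k"
    then have "m \<in> set v"
      using hd_in_set by (auto simp: suffix_words_def)
    then have "set v - {m} \<in> I" "v \<in> F (set v - {m})"
      using v by (auto simp: suffix_words_def I_def F_def)
    then show "v \<in> (\<Union>T\<in>I. F T)"
      by blast
  next
    fix v assume "v \<in> (\<Union>T\<in>I. F T)"
    then obtain T where "T \<in> I" "v \<in> F T"
      by blast
    then show "v \<in> suffix_words l m U k"
      using T[of T] by (auto simp: suffix_words_def I_def F_def)
  qed
  also have "card \<dots> = (\<Sum>T\<in>I. card (F T))"
  proof (rule card_UN_disjoint)
    show "finite I"
      using fin by (simp add: I_def)
    show "\<forall>T\<in>I. finite (F T)"
    proof
      fix T assume "T \<in> I"
      then show "finite (F T)"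
        using T by (intro finite_subset[OF _ finite_lists_length_eq[of "insert m T" l]])
          (auto simp: F_def)
    qed
    \<comment> \<open>Since \<open>m\<close> lies outside every \<open>T\<close> in
      \<open>I\<close>, the value set \<open>insert m T\<close> of a word determines
      \<open>T\<close>.\<close>
    show "\<forall>S\<in>I. \<forall>T\<in>I. S \<noteq> T \<longrightarrow> F S \<inter> F T = {}"
      using T(2) by (auto simp: F_def) (metis insert_ident)+
  qed
  also have "\<dots> = (\<Sum>T\<in>I. b_count l k)"
  proof (rule sum.cong[OF refl])
    fix S assume S: "S \<in> I"
    show "card (F S) = b_count l k"
      using b_count_eq_words_on[of "insert m S" m l] T[OF S] by (force simp: F_def)
  qed
  also have "\<dots> = (card U choose (k - 1)) * b_count l k"
    using n_subsets[OF fin, of "k - 1"] by (simp add: I_def)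
  finally show ?thesis .
qed

section \<open>Avoiding inversion sequences and the possible prefixes\<close>

definition inv_seqs :: "nat \<Rightarrow> nat list set" where
  "inv_seqs n = avoiding_inversion_sequences n {[0, 0, 0], [0, 1, 0]}"

lemma inv_seqs_iff:
  "\<sigma> \<in> inv_seqs n \<longleftrightarrow> length \<sigma> = n \<and> (\<forall>i<n. \<sigma> ! i \<le> i) \<and> repeats_dominate \<sigma>"
  unfolding inv_seqs_def avoiding_inversion_sequences_def mem_Collect_eq avoids_000_010_iff
  by (auto simp: inversion_sequence_def less_Suc_eq_le)

lemma finite_inv_seqs: "finite (inv_seqs n)"
proof (rule finite_subset[OF _ finite_lists_length_eq[of "{..n}" n]])
  show "inv_seqs n \<subseteq> {xs. set xs \<subseteq> {..n} \<and> length xs = n}"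
    by (auto simp: inv_seqs_iff in_set_conv_nth) (meson less_imp_le_nat order_trans)
qed simp

text \<open>These are the candidates for the part before the cut. The bound by \<open>m\<close> is
  strict because the cut precedes the first occurrence of the maximum.\<close>

definition prefixes :: "nat \<Rightarrow> nat \<Rightarrow> nat \<Rightarrow> nat list set" where
  "prefixes q m i = {u \<in> inv_seqs q. set u \<subseteq> {..<m} \<and> card (set u) = i}"

text \<open>Positive length excludes the empty sequence, so the value -1 of \<open>max_entry\<close>
  does not arise and \<open>Max\<close> may be used directly.\<close>

lemma a_count_int:
  assumes "0 < n"
  shows "a_count n (int j) i = card {u \<in> inv_seqs n. Max (set u) = j \<and> card (set u) = i}"
proof -
  have "u \<noteq> []" if "u \<in> inv_seqs n" for u
    using assms that by (auto simp: inv_seqs_iff)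
  then show ?thesis
    unfolding a_count_def inv_seqs_def[symmetric] max_entry_def
    by (intro arg_cong[where f = card]) auto
qed

text \<open>The prefixes are sorted by their maximum j. With \<open>m\<close> positive, j < m is the
  same as membership in \<open>{0..m-1}\<close>, which yields the innermost sum of the
  recurrence.\<close>

lemma card_prefixes:
  assumes "0 < q" "0 < m"
  shows "card (prefixes q m i) = (\<Sum>j=0..m-1. a_count q (int j) i)"
proof -
  define F where "F j = {u \<in> inv_seqs q. Max (set u) = j \<and> card (set u) = i}" for j
  have "set u \<subseteq> {..<m} \<longleftrightarrow> Max (set u) \<in> {0..m-1}" if "u \<in> inv_seqs q" for u
  proof -
    have "u \<noteq> []"
      using that assms by (auto simp: inv_seqs_iff)
    then have "set u \<subseteq> {..<m} \<longleftrightarrow> Max (set u) < m"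
      by (subst Max_less_iff) auto
    then show ?thesis
      using assms(2) by auto
  qed
  then have "prefixes q m i = (\<Union>j\<in>{0..m-1}. F j)"
    unfolding prefixes_def F_def by blast
  also have "card \<dots> = (\<Sum>j=0..m-1. card (F j))"
    by (rule card_UN_disjoint) (auto simp: F_def finite_inv_seqs)
  also have "\<dots> = (\<Sum>j=0..m-1. a_count q (int j) i)"
    using a_count_int[OF assms(1)] by (simp add: F_def)
  finally show ?thesis .
qed

section \<open>Cutting before the first maximum, and gluing back\<close>

lemma split_at_first_max:
  assumes \<sigma>: "\<sigma> \<in> inv_seqs n" "\<sigma> \<noteq> []" "Max (set \<sigma>) = m"
  obtains u v where "\<sigma> = u @ v" "u \<in> inv_seqs (length u)" "set u \<subseteq> {..<m}" "m \<le> length u"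
    "length u < n" "v \<in> suffix_words (n - length u) m ({..<m} - set u) (card (set \<sigma>) - card (set u))"
    "card (set u) < card (set \<sigma>)"
proof -
  have m: "m \<in> set \<sigma>" and le: "\<And>x. x \<in> set \<sigma> \<Longrightarrow> x \<le> m"
    using \<sigma>(2,3) Max_in[of "set \<sigma>"] by auto
  obtain u v where uv: "\<sigma> = u @ m # v" "m \<notin> set u"
    using split_list_first[OF m] by blast
  have u: "set u \<subseteq> {..<m}"
    using le uv by (fastforce simp: order_le_less)
  \<comment> \<open>A value x on both sides differs from \<open>m\<close>, so it recurs after the
    cut and x, m, x is a subsequence. Avoidance then demands m < x, against the bound on
    \<open>u\<close>.\<close>
  have disj: "set u \<inter> set (m # v) = {}"
  proof (rule ccontr)
    assume "set u \<inter> set (m # v) \<noteq> {}"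
    then obtain x where x: "x \<in> set u" "x \<in> set v"
      using uv(2) by auto
    then have "subseq ([x] @ [m] @ [x]) (u @ [m] @ v)"
      by (intro list_emb_append_mono) (auto simp: subseq_singleton_left)
    then have "m < x"
      using \<sigma>(1) uv(1) by (auto simp: inv_seqs_iff repeats_dominate_def)
    then show False
      using x u by auto
  qed
  have len: "length u < n" "length (m # v) = n - length u"
    using \<sigma>(1) uv(1) by (auto simp: inv_seqs_iff)
  have vr: "repeats_dominate u" "repeats_dominate (m # v)"
    using \<sigma>(1) repeats_dominate_append[OF disj] uv(1) by (auto simp: inv_seqs_iff)
  \<comment> \<open>The entry at this position is the first \<open>m\<close>, so the inversion bound
    there shows that the prefix has length at least \<open>m\<close>.\<close>
  have "\<sigma> ! length u \<le> length u"
    using \<sigma>(1) len by (auto simp: inv_seqs_iff)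
  then have mle: "m \<le> length u"
    by (simp add: uv)
  have "u ! i \<le> i" if "i < length u" for i
    using \<sigma>(1) that len(1) uv(1) by (auto simp: inv_seqs_iff nth_append split: if_splits dest: spec[of _ i])
  then have u_inv: "u \<in> inv_seqs (length u)"
    using vr by (simp add: inv_seqs_iff)
  have card_add: "card (set \<sigma>) = card (set u) + card (set (m # v))"
    using card_Un_disjoint[OF _ _ disj] uv(1) by auto
  have "set (m # v) \<subseteq> insert m ({..<m} - set u)"
    using le disj uv(1) by (fastforce simp: order_le_less)
  then have "m # v \<in> suffix_words (n - length u) m ({..<m} - set u) (card (set \<sigma>) - card (set u))"
    using len vr card_add by (simp add: suffix_words_def)
  moreover have "card (set u) < card (set \<sigma>)"
    using card_add by (simp add: card_gt_0_iff)
  ultimately show thesis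
    using that uv(1) u_inv u mle len(1) by blast
qed

text \<open>Entries of \<open>v\<close> are at most \<open>m\<close> and stand at positions from
  \<open>q\<close> on, so \<open>m \<le> q\<close> gives the inversion bound for them. Avoidance and
  the count of values follow from the disjointness of the two value sets.\<close>

lemma append_suffix_word:
  assumes u: "u \<in> inv_seqs q" "set u \<subseteq> {..<m}"
    and q: "m \<le> q" "q < n"
    and v: "v \<in> suffix_words (n - q) m ({..<m} - set u) k"
  shows "u @ v \<in> inv_seqs n" "Max (set (u @ v)) = m" "card (set (u @ v)) = card (set u) + k"
proof -
  have len: "length u = q" "length v = n - q"
    using u v by (auto simp: inv_seqs_iff suffix_words_def)
  have v_set: "set v \<subseteq> insert m ({..<m} - set u)" and m: "m \<in> set v"
    using v hd_in_set by (auto simp: suffix_words_def)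
  have disj: "set u \<inter> set v = {}"
    using u(2) v_set by auto
  have v_le: "x \<le> m" if "x \<in> set v" for x
    using v_set that by auto
  have "(u @ v) ! i \<le> i" if "i < n" for i
  proof (cases "i < q")
    case True
    then show ?thesis
      using u len by (simp add: inv_seqs_iff nth_append)
  next
    case False
    then have "(u @ v) ! i \<in> set v"
      using len that by (auto simp: nth_append)
    then show ?thesis
      using v_le q False by fastforce
  qed
  then show "u @ v \<in> inv_seqs n"
    using len q u v repeats_dominate_append[OF disj] by (auto simp: inv_seqs_iff suffix_words_def)
  show "Max (set (u @ v)) = m"
    using u(2) v_le m by (intro Max_eqI) (auto intro: less_imp_le)
  show "card (set (u @ v)) = card (set u) + k"
    using card_Un_disjoint[OF _ _ disj] v by (auto simp: suffix_words_def)
qed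

section \<open>The recurrence, by counting pairs of prefix and suffix\<close>

theorem theorem19:
  fixes n m d :: nat
  assumes "2 \<le> d" and "d \<le> m + 1" and "m + 1 \<le> n"
  shows "a_count n (int m) d =
    (\<Sum>i=0..d-1. ((m - i) choose (d - i - 1)) *
       (\<Sum>p=m+1..n. b_count (n - p + 1) (d - i) *
          (\<Sum>j=0..m-1. a_count (p - 1) (int j) i)))"
proof -
  have m: "0 < m"
    using assms by simp
  define W where "W u = suffix_words (n - length u) m ({..<m} - set u) (d - card (set u))" for u
  \<comment> \<open>In a pair (i, p), i is the number of distinct values before the cut and p the
    position of the first maximum counted from 1. The prefix thus has length
    \<open>p - 1\<close>.\<close>
  define I where "I = {0..d-1} \<times> {m+1..n}"
  define P where "P = (\<lambda>(i, p). prefixes (p - 1) m i)"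
  define A where "A = {\<sigma> \<in> inv_seqs n. Max (set \<sigma>) = m \<and> card (set \<sigma>) = d}"
  \<comment> \<open>A dependent sum is used because the values allowed in the suffix depend on the
    prefix itself, and not only on its length.\<close>
  define S where "S = (SIGMA u:(\<Union>x\<in>I. P x). W u)"
  have fin_W: "finite (W u)" for u
    by (simp add: W_def finite_suffix_words)
  have fin_P: "finite (P x)" for x
    by (auto simp: P_def prefixes_def finite_inv_seqs split: prod.split)
  have P_iff: "u \<in> (\<Union>x\<in>I. P x) \<longleftrightarrow> u \<in> inv_seqs (length u) \<and> set u \<subseteq> {..<m} \<and>
      card (set u) < d \<and> m \<le> length u \<and> length u < n" for u
  proof
    assume "u \<in> (\<Union>x\<in>I. P x)"
    then show "u \<in> inv_seqs (length u) \<and> set u \<subseteq> {..<m} \<and> card (set u) < d \<and>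
        m \<le> length u \<and> length u < n"
      using assms by (auto simp: I_def P_def prefixes_def inv_seqs_iff)
  next
    assume u: "u \<in> inv_seqs (length u) \<and> set u \<subseteq> {..<m} \<and> card (set u) < d \<and>
        m \<le> length u \<and> length u < n"
    then have "(card (set u), length u + 1) \<in> I" "u \<in> P (card (set u), length u + 1)"
      by (auto simp: I_def P_def prefixes_def)
    then show "u \<in> (\<Union>x\<in>I. P x)"
      by blast
  qed
  have inj: "inj_on (\<lambda>(u, v). u @ v) S"
  proof -
    \<comment> \<open>The prefix avoids \<open>m\<close> and the suffix starts with it, so the cut
      can be read off the concatenation.\<close>
    have takeWhile_app: "takeWhile (\<lambda>x. x \<noteq> m) (u @ v) = u" if "(u, v) \<in> S" for u v
    proof -
      have "m \<notin> set u" "v \<noteq> []" "hd v = m"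
        using that P_iff by (auto simp: S_def W_def suffix_words_def)
      then show ?thesis
        by (cases v) (auto simp: takeWhile_append)
    qed
    show ?thesis
    proof (rule inj_onI, clarify)
      fix u v u' v' assume "(u, v) \<in> S" "(u', v') \<in> S" and eq: "u @ v = u' @ v'"
      then have "u = u'"
        using takeWhile_app by metis
      then show "u = u' \<and> v = v'"
        using eq by simp
    qed
  qed
  have "(\<lambda>(u, v). u @ v) ` S = A"
  proof (intro equalityI subsetI)
    fix \<sigma> assume "\<sigma> \<in> (\<lambda>(u, v). u @ v) ` S"
    then obtain u v where \<sigma>: "\<sigma> = u @ v" and u: "u \<in> (\<Union>x\<in>I. P x)" and v: "v \<in> W u"
      by (auto simp: S_def)
    show "\<sigma> \<in> A"
      using u append_suffix_word[of u "length u" m n v "d - card (set u)"] v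
      unfolding P_iff by (auto simp: A_def \<sigma> W_def)
  next
    fix \<sigma> assume "\<sigma> \<in> A"
    then have \<sigma>: "\<sigma> \<in> inv_seqs n" "Max (set \<sigma>) = m" "card (set \<sigma>) = d"
      by (auto simp: A_def)
    then have "\<sigma> \<noteq> []"
      using assms by (auto simp: inv_seqs_iff)
    then obtain u v where uv: "\<sigma> = u @ v" "u \<in> inv_seqs (length u)" "set u \<subseteq> {..<m}"
      "m \<le> length u" "length u < n" "v \<in> W u" "card (set u) < d"
      unfolding W_def using split_at_first_max[OF \<sigma>(1) _ \<sigma>(2)] \<sigma>(3) by metis
    then have "(u, v) \<in> S"
      unfolding S_def using P_iff by blast
    then show "\<sigma> \<in> (\<lambda>(u, v). u @ v) ` S"
      using uv(1) by force
  qed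
  then have "a_count n (int m) d = card S"
    using inj a_count_int[of n m d] assms card_image by (force simp: A_def)
  also have "\<dots> = (\<Sum>u\<in>(\<Union>x\<in>I. P x). card (W u))"
    unfolding S_def by (rule card_SigmaI) (auto simp: fin_W fin_P I_def)
  also have "\<dots> = (\<Sum>x\<in>I. \<Sum>u\<in>P x. card (W u))"
  proof (rule sum.UNION_disjoint)
    \<comment> \<open>A prefix determines i as its number of distinct values and p through its
      length; as p is positive, \<open>p - 1\<close> determines p.\<close>
    show "\<forall>x\<in>I. \<forall>y\<in>I. x \<noteq> y \<longrightarrow> P x \<inter> P y = {}"
      by (auto simp: I_def P_def prefixes_def inv_seqs_iff)
  qed (simp_all add: fin_P I_def)
  also have "\<dots> = (\<Sum>(i, p)\<in>I. ((m - i) choose (d - i - 1)) *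
      (b_count (n - p + 1) (d - i) * (\<Sum>j=0..m-1. a_count (p - 1) (int j) i)))"
  proof (rule sum.cong[OF refl])
    fix x assume x: "x \<in> I"
    obtain i p where ip: "x = (i, p)" "i < d" "m < p" "p \<le> n"
      using x assms by (auto simp: I_def)
    have "card (W u) = ((m - i) choose (d - i - 1)) * b_count (n - p + 1) (d - i)"
      if "u \<in> P x" for u
    proof -
      have u: "length u = p - 1" "set u \<subseteq> {..<m}" "card (set u) = i"
        using that by (auto simp: P_def prefixes_def inv_seqs_iff ip)
      then have "card ({..<m} - set u) = m - i"
        by (simp add: card_Diff_subset)
      moreover have "n - (p - 1) = n - p + 1"
        using ip by simp
      ultimately show ?thesis
        unfolding W_def u using ip by (subst card_suffix_words) auto
    qed
    then have "(\<Sum>u\<in>P x. card (W u)) =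
        card (P x) * (((m - i) choose (d - i - 1)) * b_count (n - p + 1) (d - i))"
      by simp
    also have "card (P x) = (\<Sum>j=0..m-1. a_count (p - 1) (int j) i)"
      using card_prefixes[of "p - 1" m i] ip m by (simp add: P_def)
    finally show "(\<Sum>u\<in>P x. card (W u)) = (case x of (i, p) \<Rightarrow> ((m - i) choose (d - i - 1)) *
        (b_count (n - p + 1) (d - i) * (\<Sum>j=0..m-1. a_count (p - 1) (int j) i)))"
      using ip by (simp add: mult_ac)
  qed
  also have "\<dots> = (\<Sum>i=0..d-1. ((m - i) choose (d - i - 1)) *
       (\<Sum>p=m+1..n. b_count (n - p + 1) (d - i) *
          (\<Sum>j=0..m-1. a_count (p - 1) (int j) i)))"
    unfolding I_def sum.cartesian_product[symmetric] by (simp only: sum_distrib_left)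
  finally show ?thesis .
qed

end
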